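(* Let $H$ be a separable infinite dimensional real Hilbert space. Then there is $T\in\mathcal{L}(H)$ such that: (i) $T$ is a compact operator; (ii) $1=\nu(T)<\|T\|$ and $T$ attains its numerical radius; (iii) given $\varepsilon>0$, there is $\eta(\varepsilon)>0$ such that whenever $x_0\in S_H$ satisfies $|\langle Tx_0,x_0\rangle|>1-\eta(\varepsilon)$, there is $x_1\in S_H$ such that $\nu(T)=\langle Tx_1,x_1\rangle=1$ and $\|x_1-x_0\|<\varepsilon$. In particular, $T\in\mathcal{A}_{\mathrm{nu}}(H)$ and $T\notin\mathcal{A}_{\|\cdot\|}(H,H)$.
   Context: $S_X$ is the unit sphere of a Banach space $X$, $X^*$ the topological dual, $\mathcal{L}(X,Y)$ the bounded linear operators from $X$ to $Y$, $\mathcal{L}(X)=\mathcal{L}(X,X)$, and $\langle x^*,x\rangle=x^*(x)$ (in a Hilbert space $H$, with $H^*$ identified with $H$, this is the inner product). An operator $T\in\mathcal{L}(X,Y)$ attains its norm if $\|T(x_0)\|=\|T\|$ for some $x_0\in S_X$. Let $\Pi(X)=\{(x,x^* )\in S_X\times S_{X^*}:\langle x^*,x\rangle=1\}$ and, for $T\in\mathcal{L}(X)$, $\nu(T)=\sup\{|\langle x^*,T(x)\rangle|:(x,x^* )\in\Pi(X)\}$; $T$ attains its numerical radius if this supremum is attained. $\mathcal{A}_{\|\cdot\|}(X,Y)$ is the set of all norm-attaining $T\in\mathcal{L}(X,Y)$ with $\|T\|=1$ such that for every $\varepsilon>0$ there is $\eta(\varepsilon,T)>0$ such that whenever $x\in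 S_X$ satisfies $\|T(x)\|>1-\eta(\varepsilon,T)$, there is $x_0\in S_X$ with $\|T(x_0)\|=1$ and $\|x_0-x\|<\varepsilon$. $\mathcal{A}_{\mathrm{nu}}(X)$ is the set of all numerical radius attaining $T\in\mathcal{L}(X)$ with $\nu(T)=1$ such that for every $\varepsilon>0$ there is $\eta(\varepsilon,T)>0$ such that whenever $(x,x^* )\in\Pi(X)$ satisfies $|\langle x^*,T(x)\rangle|>1-\eta(\varepsilon,T)$, there is $(x_0,x_0^* )\in\Pi(X)$ with $|\langle x_0^*,T(x_0)\rangle|=1$, $\|x_0-x\|<\varepsilon$ and $\|x_0^*-x^*\|<\varepsilon$. *)

theory Defs
  imports "HOL-Analysis.Analysis"
begin

(* The dual of X is the type of bounded linear functionals with its operator norm. *)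

definition state_pairs :: "('a::real_normed_vector \<times> ('a \<Rightarrow>\<^sub>L real)) set" where
  "state_pairs = {(x, f). norm x = 1 \<and> norm f = 1 \<and> blinfun_apply f x = 1}"

(* The supremum is over a set bounded by the norm of T. It is nonempty unless X = 0, in which
   case the value of the real-valued SUP is unspecified. *)
definition numerical_radius :: "('a::real_normed_vector \<Rightarrow>\<^sub>L 'a) \<Rightarrow> real" where
  "numerical_radius T =
     (SUP (x, f)\<in>state_pairs. \<bar>blinfun_apply f (blinfun_apply T x)\<bar>)"

definition attains_norm ::
  "('a::real_normed_vector \<Rightarrow>\<^sub>L 'b::real_normed_vector) \<Rightarrow> bool" where
  "attains_norm T \<longleftrightarrow> (\<exists>x. norm x = 1 \<and> norm (blinfun_apply T x) = norm T)"

definition attains_numerical_radius :: "('a::real_normed_vector \<Rightarrow>\<^sub>L 'a) \<Rightarrow> bool" where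
  "attains_numerical_radius T \<longleftrightarrow>
     (\<exists>(x, f)\<in>state_pairs. \<bar>blinfun_apply f (blinfun_apply T x)\<bar> = numerical_radius T)"

definition A_norm :: "('a::real_normed_vector \<Rightarrow>\<^sub>L 'b::real_normed_vector) set" where
  "A_norm = {T. attains_norm T \<and> norm T = 1 \<and>
     (\<forall>\<epsilon>>0. \<exists>\<eta>>0. \<forall>x. norm x = 1 \<and> norm (blinfun_apply T x) > 1 - \<eta> \<longrightarrow>
        (\<exists>x0. norm x0 = 1 \<and> norm (blinfun_apply T x0) = 1 \<and> norm (x0 - x) < \<epsilon>))}"

definition A_nu :: "('a::real_normed_vector \<Rightarrow>\<^sub>L 'a) set" where
  "A_nu = {T. attains_numerical_radius T \<and> numerical_radius T = 1 \<and>
     (\<forall>\<epsilon>>0. \<exists>\<eta>>0. \<forall>(x, f)\<in>state_pairs.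
        \<bar>blinfun_apply f (blinfun_apply T x)\<bar> > 1 - \<eta> \<longrightarrow>
        (\<exists>(x0, f0)\<in>state_pairs. \<bar>blinfun_apply f0 (blinfun_apply T x0)\<bar> = 1 \<and>
           norm (x0 - x) < \<epsilon> \<and> norm (f0 - f) < \<epsilon>))}"

definition compact_operator ::
  "('a::real_normed_vector \<Rightarrow>\<^sub>L 'b::real_normed_vector) \<Rightarrow> bool" where
  "compact_operator T \<longleftrightarrow> compact (closure (blinfun_apply T ` cball 0 1))"

end

(* The operator T x = <x,u> u + (<x,u> v - <x,v> u), for orthonormal u and v, is the projection
   onto the line of u plus a skew operator. The skew part is invisible to the quadratic form, so
   <T x, x> = <x,u>^2, which is close to 1 on the unit sphere only near u and -u, whereas
   T u = u + v already has norm sqrt 2. In a Hilbert space the only functional that norms x is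
   the inner product with x, which turns statements on state pairs into statements on the
   quadratic form. *)

theory Submission
  imports Defs
begin

text \<open>If \<open>f\<close> has norm 1 and value 1 at the unit vector \<open>x\<close>, it
  vanishes on the orthogonal complement of \<open>x\<close>: moving from \<open>x\<close> in an
  orthogonal direction changes the squared norm only to second order, while a nonzero value of
  \<open>f\<close> there would matter to first order. Splitting a vector along \<open>x\<close> then
  identifies \<open>f\<close>. The converse is Cauchy-Schwarz, with equality at
  \<open>x\<close>.\<close>

lemma state_pairs_inner:
  "(x, f) \<in> state_pairs \<longleftrightarrow> norm x = 1 \<and> f = blinfun_inner_left (x :: 'a::real_inner)"
proof
  assume "(x, f) \<in> state_pairs"
  then have x: "norm x = 1" and f: "norm f = 1" and fx: "blinfun_apply f x = 1"
    by (auto simp: state_pairs_def)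
  have xx: "x \<bullet> x = 1"
    using x by (simp add: dot_square_norm)
  have orth: "blinfun_apply f y = 0" if "x \<bullet> y = 0" for y
  proof (rule ccontr)
    assume c: "blinfun_apply f y \<noteq> 0"
    define c where "c = blinfun_apply f y"
    define n where "n = y \<bullet> y"
    have "y \<noteq> 0" using c by auto
    then have n: "n > 0" by (simp add: n_def)
    \<comment> \<open>With this \<open>t\<close> the second-order term \<open>t\<^sup>2 * n\<close>
      equals \<open>t * c\<close>, so the norm bound becomes
      \<open>t * c + (t * c)\<^sup>2 \<le> 0\<close>, although \<open>t * c\<close> is the positive
      number \<open>c\<^sup>2 / n\<close>.\<close>
    define t where "t = c / n"
    have "\<bar>blinfun_apply f (x + t *\<^sub>R y)\<bar> \<le> norm (x + t *\<^sub>R y)"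
      using norm_blinfun[of f "x + t *\<^sub>R y"] f by simp
    then have "(blinfun_apply f (x + t *\<^sub>R y))\<^sup>2 \<le> (norm (x + t *\<^sub>R y))\<^sup>2"
      by (metis abs_ge_zero power2_abs power_mono)
    also have "(norm (x + t *\<^sub>R y))\<^sup>2 = 1 + t\<^sup>2 * n"
      using that xx unfolding power2_norm_eq_inner
      by (simp add: inner_add_left inner_add_right inner_commute n_def power2_eq_square)
    also have "blinfun_apply f (x + t *\<^sub>R y) = 1 + t * c"
      by (simp add: blinfun.add_right blinfun.scaleR_right fx c_def)
    finally have "2 * (t * c) + (t * c)\<^sup>2 \<le> t\<^sup>2 * n"
      by (simp add: power2_sum)
    moreover have "t\<^sup>2 * n = t * c"
      using n by (simp add: t_def power2_eq_square)
    moreover have "t * c > 0"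
      using c n by (auto simp: t_def c_def zero_less_mult_iff zero_less_divide_iff linorder_neq_iff)
    ultimately show False
      by (smt (verit) zero_le_power2)
  qed
  have "blinfun_apply f y = y \<bullet> x" for y
  proof -
    have "blinfun_apply f (y - (y \<bullet> x) *\<^sub>R x) = 0"
      by (rule orth) (simp add: inner_diff_right xx inner_commute)
    then show ?thesis
      by (simp add: blinfun.diff_right blinfun.scaleR_right fx)
  qed
  then show "norm x = 1 \<and> f = blinfun_inner_left x"
    using x by (auto intro!: blinfun_eqI)
next
  assume *: "norm x = 1 \<and> f = blinfun_inner_left x"
  then have xx: "x \<bullet> x = 1"
    by (simp add: dot_square_norm)
  have "norm f \<le> 1"
    using * Cauchy_Schwarz_ineq2[of _ x] by (intro norm_blinfun_bound) (auto simp: inner_commute)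
  moreover have "1 \<le> norm f"
    using norm_blinfun[of f x] * xx by simp
  ultimately show "(x, f) \<in> state_pairs"
    using * xx by (simp add: state_pairs_def)
qed

text \<open>The difference is the inner product with \<open>x - y\<close>, so Cauchy-Schwarz
  applies. In \<open>A_nu\<close> this makes the closeness of functionals follow from that of
  vectors.\<close>

lemma norm_blinfun_inner_left_diff_le:
  "norm (blinfun_inner_left x - blinfun_inner_left y) \<le> norm (x - y)"
proof (rule norm_blinfun_bound)
  fix z
  show "norm (blinfun_apply (blinfun_inner_left x - blinfun_inner_left y) z) \<le> norm (x - y) * norm z"
    using Cauchy_Schwarz_ineq2[of z "x - y"]
    by (simp add: blinfun.diff_left inner_diff_right mult.commute)
qed simp

text \<open>Two steps of Gram-Schmidt: neither the empty set nor a single vector spans the space,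
  which gives a nonzero vector and then one outside its line.\<close>

lemma ex_orthonormal_pair:
  assumes "\<not> (\<exists>B::'a::real_inner set. finite B \<and> span B = UNIV)"
  obtains u v :: "'a::real_inner" where "norm u = 1" "norm v = 1" "u \<bullet> v = 0"
proof -
  have "span {} \<noteq> (UNIV :: 'a set)"
    using assms by blast
  then obtain a :: 'a where a: "a \<noteq> 0"
    by auto
  define u where "u = a /\<^sub>R norm a"
  have u: "norm u = 1"
    using a by (simp add: u_def)
  have "span {u} \<noteq> UNIV"
    using assms by blast
  then obtain y where y: "y \<notin> span {u}"
    by auto
  define w where "w = y - (u \<bullet> y) *\<^sub>R u"
  have "w \<noteq> 0"
    using y by (auto simp: w_def span_singleton)
  moreover have "u \<bullet> w = 0"
    using u by (simp add: w_def inner_diff_right dot_square_norm)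
  ultimately show ?thesis
    by (intro that[of u "w /\<^sub>R norm w"]) (use u in auto)
qed

theorem proposition2p8:
  assumes separable: "separable_space (euclidean :: 'h::{real_inner, complete_space} topology)"
    and infinite_dimensional: "\<not> (\<exists>B::'h set. finite B \<and> span B = UNIV)"
  shows "\<exists>T::'h \<Rightarrow>\<^sub>L 'h.
      compact_operator T \<and>
      (1 = numerical_radius T \<and> numerical_radius T < norm T \<and> attains_numerical_radius T) \<and>
      (\<forall>\<epsilon>>0. \<exists>\<eta>>0. \<forall>x0. norm x0 = 1 \<and> \<bar>blinfun_apply T x0 \<bullet> x0\<bar> > 1 - \<eta> \<longrightarrow>
         (\<exists>x1. norm x1 = 1 \<and> numerical_radius T = blinfun_apply T x1 \<bullet> x1 \<and>
            blinfun_apply T x1 \<bullet> x1 = 1 \<and> norm (x1 - x0) < \<epsilon>)) \<and>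
      T \<in> A_nu \<and> T \<notin> A_norm"
proof -
  obtain u v :: 'h where u: "norm u = 1" and v: "norm v = 1" and uv: "u \<bullet> v = 0"
    using ex_orthonormal_pair[OF infinite_dimensional] .
  have uu: "u \<bullet> u = 1" and vv: "v \<bullet> v = 1" and vu: "v \<bullet> u = 0"
    using u v uv by (simp_all add: dot_square_norm inner_commute)
  define T where
    "T = Blinfun (\<lambda>x::'h. (x \<bullet> u - x \<bullet> v) *\<^sub>R u + (x \<bullet> u) *\<^sub>R v)"
  have "bounded_linear (\<lambda>x::'h. (x \<bullet> u - x \<bullet> v) *\<^sub>R u + (x \<bullet> u) *\<^sub>R v)"
    by (intro bounded_linear_intros)
  then have T: "blinfun_apply T x = (x \<bullet> u - x \<bullet> v) *\<^sub>R u + (x \<bullet> u) *\<^sub>R v" for x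
    by (simp add: T_def bounded_linear_Blinfun_apply)
  have form: "blinfun_apply T x \<bullet> x = (x \<bullet> u)\<^sup>2" for x
    by (simp add: T inner_add_left inner_commute power2_eq_square algebra_simps)
  have form_le: "(x \<bullet> u)\<^sup>2 \<le> 1" if "norm x = 1" for x
    using Cauchy_Schwarz_ineq2[of x u] that u by (simp add: abs_square_le_1)
  have u_pair: "(u, blinfun_inner_left u) \<in> state_pairs"
    using u by (simp add: state_pairs_inner)
  have radius: "numerical_radius T = 1"
    unfolding numerical_radius_def
  \<comment> \<open>The value 1 is taken at \<open>u\<close> paired with its own functional, and
    \<open>form_le\<close> bounds all other values.\<close>
  proof (rule cSup_eq_maximum)
    show "1 \<in> (\<lambda>(x, f). \<bar>blinfun_apply f (blinfun_apply T x)\<bar>) ` state_pairs"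
      using u_pair by (intro image_eqI[of _ _ "(u, blinfun_inner_left u)"]) (auto simp: form uu)
  qed (auto simp: state_pairs_inner form form_le)
  have attains: "attains_numerical_radius T"
    unfolding attains_numerical_radius_def radius
    using u_pair by (intro bexI[of _ "(u, blinfun_inner_left u)"]) (auto simp: form uu)
  have norm_T: "norm T > 1"
  proof -
    have "(norm (blinfun_apply T u))\<^sup>2 = 2"
      unfolding power2_norm_eq_inner by (simp add: T inner_add_left inner_add_right uu uv vu vv)
    then have "norm (blinfun_apply T u) > 1"
      by (smt (verit) norm_ge_zero power_le_one)
    then show ?thesis
      using norm_blinfun[of T u] u by simp
  qed
  have compact_T: "compact_operator T"
    unfolding compact_operator_def
  proof -
    \<comment> \<open>\<open>T\<close> has its range in the plane of \<open>u\<close> and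
      \<open>v\<close>. On the unit ball both inner products are at most 1 in absolute value, so the
      coefficient of \<open>u\<close>, being their difference, is at most 2.\<close>
    define K where "K = (\<lambda>(a, b). a *\<^sub>R u + b *\<^sub>R v) ` (cball (0::real) 2 \<times> cball (0::real) 1)"
    have "compact K"
      unfolding K_def case_prod_unfold
      by (intro compact_continuous_image compact_Times compact_cball continuous_intros)
    moreover have "blinfun_apply T ` cball 0 1 \<subseteq> K"
    proof (rule image_subsetI)
      fix x :: 'h
      assume "x \<in> cball 0 1"
      then have "\<bar>x \<bullet> u\<bar> \<le> 1" "\<bar>x \<bullet> v\<bar> \<le> 1"
        using Cauchy_Schwarz_ineq2[of x u] Cauchy_Schwarz_ineq2[of x v] u v by auto
      then show "blinfun_apply T x \<in> K"
        unfolding K_def T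
        by (intro image_eqI[of _ _ "(x \<bullet> u - x \<bullet> v, x \<bullet> u)"]) auto
    qed
    ultimately have "closure (blinfun_apply T ` cball 0 1) \<subseteq> K"
      by (simp add: closure_minimal compact_imp_closed)
    then show "compact (closure (blinfun_apply T ` cball 0 1))"
      using \<open>compact K\<close> compact_Int_closed[of K "closure (blinfun_apply T ` cball 0 1)"]
      by (simp add: Int_absorb1)
  qed
  \<comment> \<open>The threshold comes from the chain below: the squared distance from
    \<open>x\<close> to the nearer of \<open>u\<close> and \<open>-u\<close> is at most
    \<open>2 - 2 * (x \<bullet> u)\<^sup>2\<close>, which is less than
    \<open>\<epsilon>\<^sup>2\<close> exactly under this hypothesis.\<close>
  have near: "\<exists>x1. norm x1 = 1 \<and> blinfun_apply T x1 \<bullet> x1 = 1 \<and> norm (x1 - x) < \<epsilon>"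
    if "\<epsilon> > 0" "norm x = 1" "\<bar>blinfun_apply T x \<bullet> x\<bar> > 1 - \<epsilon>\<^sup>2 / 2" for \<epsilon> x
  proof -
    \<comment> \<open>The sign selects whichever of \<open>u\<close> and \<open>-u\<close> is nearer
      to \<open>x\<close>. Taking 1 when \<open>x \<bullet> u = 0\<close> keeps
      \<open>s * s = 1\<close>, where \<open>sgn\<close> would give 0.\<close>
    define s :: real where "s = (if x \<bullet> u \<ge> 0 then 1 else -1)"
    have s: "s * s = 1" "\<bar>s\<bar> = 1" "s * (x \<bullet> u) = \<bar>x \<bullet> u\<bar>"
      by (auto simp: s_def)
    have xx: "x \<bullet> x = 1"
      using that(2) by (simp add: dot_square_norm)
    have "(norm (s *\<^sub>R u - x))\<^sup>2 = 2 - 2 * \<bar>x \<bullet> u\<bar>"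
      unfolding power2_norm_eq_inner s(3)[symmetric]
      using xx s(1) by (simp add: inner_diff_left inner_diff_right uu inner_commute)
    \<comment> \<open>A number in the unit interval dominates its square.\<close>
    also have "\<dots> \<le> 2 - 2 * (x \<bullet> u)\<^sup>2"
      using form_le[OF that(2)] abs_square_le_1[of "x \<bullet> u"]
        mult_left_le[of "\<bar>x \<bullet> u\<bar>" "\<bar>x \<bullet> u\<bar>"]
      by (simp add: power2_eq_square)
    also have "\<dots> < \<epsilon>\<^sup>2"
      using that(3) by (simp add: form)
    finally have "norm (s *\<^sub>R u - x) < \<epsilon>"
      using \<open>\<epsilon> > 0\<close> by (simp add: power_less_imp_less_base)
    moreover have "blinfun_apply T (s *\<^sub>R u) \<bullet> (s *\<^sub>R u) = 1"
      unfolding form using s(1) by (simp add: uu power2_eq_square)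
    ultimately show ?thesis
      using s(2) u by (intro exI[of _ "s *\<^sub>R u"]) simp
  qed
  have "T \<in> A_nu"
    unfolding A_nu_def
  proof (intro CollectI conjI attains radius allI impI)
    fix \<epsilon> :: real
    assume \<epsilon>: "\<epsilon> > 0"
    show "\<exists>\<eta>>0. \<forall>(x, f)\<in>state_pairs. \<bar>blinfun_apply f (blinfun_apply T x)\<bar> > 1 - \<eta> \<longrightarrow>
        (\<exists>(x0, f0)\<in>state_pairs. \<bar>blinfun_apply f0 (blinfun_apply T x0)\<bar> = 1 \<and>
           norm (x0 - x) < \<epsilon> \<and> norm (f0 - f) < \<epsilon>)"
    proof (intro exI[of _ "\<epsilon>\<^sup>2 / 2"] conjI ballI, goal_cases)
      case (2 p)
      obtain x where p: "p = (x, blinfun_inner_left x)" "norm x = 1"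
        using 2 by (cases p) (auto simp: state_pairs_inner)
      show ?case
        unfolding p(1) split_conv
      proof
        assume "\<bar>blinfun_apply (blinfun_inner_left x) (blinfun_apply T x)\<bar> > 1 - \<epsilon>\<^sup>2 / 2"
        then obtain x1 where "norm x1 = 1" "blinfun_apply T x1 \<bullet> x1 = 1" "norm (x1 - x) < \<epsilon>"
          using near[OF \<epsilon> p(2)] by auto
        then show "\<exists>(x0, f0)\<in>state_pairs. \<bar>blinfun_apply f0 (blinfun_apply T x0)\<bar> = 1 \<and>
            norm (x0 - x) < \<epsilon> \<and> norm (f0 - blinfun_inner_left x) < \<epsilon>"
          \<comment> \<open>The functional paired with \<open>x1\<close> is forced, and it is no
            farther from that of \<open>x\<close> than \<open>x1\<close> is from
            \<open>x\<close>.\<close>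
          using norm_blinfun_inner_left_diff_le[of x1 x]
          by (intro bexI[of _ "(x1, blinfun_inner_left x1)"]) (auto simp: state_pairs_inner)
      qed
    qed (use \<epsilon> in simp)
  qed
  \<comment> \<open>Membership in \<open>A_norm\<close> includes \<open>norm T = 1\<close>, so the
    strict inequality settles this.\<close>
  moreover have "T \<notin> A_norm"
    using norm_T by (simp add: A_norm_def)
  moreover have "\<exists>\<eta>>0. \<forall>x0. norm x0 = 1 \<and> \<bar>blinfun_apply T x0 \<bullet> x0\<bar> > 1 - \<eta> \<longrightarrow>
         (\<exists>x1. norm x1 = 1 \<and> numerical_radius T = blinfun_apply T x1 \<bullet> x1 \<and>
            blinfun_apply T x1 \<bullet> x1 = 1 \<and> norm (x1 - x0) < \<epsilon>)" if "\<epsilon> > 0" for \<epsilon>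
    using near[OF that] that by (intro exI[of _ "\<epsilon>\<^sup>2 / 2"]) (auto simp: radius)
  ultimately show ?thesis
    using compact_T radius norm_T attains by (intro exI[of _ T]) auto
qed

end
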